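(* There exists a perfect subgroup $G$ of the special linear group $\mathrm{SL}_6(\mathbb{F}_4)$ such that the direct power $G^4$ contains a subdirect subgroup which has a nilpotent quotient of class $2$.
   Context: $\mathbb{F}_4$ is the field with $4$ elements. A group $G$ is perfect if $[G,G]=G$. A subgroup of a direct product is subdirect if its projection to each factor is surjective. "Class $2$" means nilpotency class exactly $2$. *)

theory Defs
  imports
    "HOL-Algebra.Generated_Groups"
    "HOL-Algebra.Product_Groups"
    "Jordan_Normal_Form.Determinant"
begin

definition SL :: "nat \<Rightarrow> 'f::field mat monoid" where
  "SL n = \<lparr>carrier = {A \<in> carrier_mat n n. det A = 1}, monoid.mult = (*), one = 1\<^sub>m n\<rparr>"

lemma group_SL: "group (SL n :: 'f::field mat monoid)"
proof (rule groupI)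
  fix A :: "'f mat" assume A: "A \<in> carrier (SL n)"
  then have c: "A \<in> carrier_mat n n" "det A = 1" by (auto simp: SL_def)
  have B: "adj_mat A \<in> carrier_mat n n" "adj_mat A * A = 1\<^sub>m n"
    using adj_mat[OF c(1)] c(2) by auto
  have "det (adj_mat A) = 1"
    using det_mult[OF B(1) c(1)] B(2) c(2) by simp
  then show "\<exists>B \<in> carrier (SL n). B \<otimes>\<^bsub>SL n\<^esub> A = \<one>\<^bsub>SL n\<^esub>"
    using B by (auto simp: SL_def intro!: bexI[of _ "adj_mat A"])
qed (auto simp: SL_def det_mult assoc_mult_mat)

definition perfect_group :: "('a, 'b) monoid_scheme \<Rightarrow> bool" where
  "perfect_group G \<longleftrightarrow> group G \<and> derived G (carrier G) = carrier G"

definition subdirect_subgroup ::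
    "'i set \<Rightarrow> ('i \<Rightarrow> ('a, 'b) monoid_scheme) \<Rightarrow> ('i \<Rightarrow> 'a) set \<Rightarrow> bool" where
  "subdirect_subgroup I G H \<longleftrightarrow>
     subgroup H (product_group I G) \<and> (\<forall>i\<in>I. (\<lambda>x. x i) ` H = carrier (G i))"

text \<open>The lower central series, indexed from \<open>0\<close>: term \<open>n\<close> is what is usually written
  \<open>\<gamma>\<close> with index \<open>n + 1\<close>, so that a group of class \<open>c\<close> has trivial term \<open>c\<close>.\<close>

primrec lower_central :: "('a, 'b) monoid_scheme \<Rightarrow> nat \<Rightarrow> 'a set" where
  "lower_central G 0 = carrier G"
| "lower_central G (Suc n) = generate G
     (\<Union>x \<in> lower_central G n. \<Union>y \<in> carrier G.
        {x \<otimes>\<^bsub>G\<^esub> y \<otimes>\<^bsub>G\<^esub> inv\<^bsub>G\<^esub> x \<otimes>\<^bsub>G\<^esub> inv\<^bsub>G\<^esub> y})"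

definition nilpotent_group :: "('a, 'b) monoid_scheme \<Rightarrow> bool" where
  "nilpotent_group G \<longleftrightarrow> group G \<and> (\<exists>n. lower_central G n = {\<one>\<^bsub>G\<^esub>})"

definition nilpotency_class :: "('a, 'b) monoid_scheme \<Rightarrow> nat" where
  "nilpotency_class G = (LEAST n. lower_central G n = {\<one>\<^bsub>G\<^esub>})"

end

theory Submission
  imports Defs
begin

text \<open>Let \<open>R\<close> be the algebra over the field of order four with basis \<open>1, e, f, ef\<close> and
  \<open>e\<^sup>2 = f\<^sup>2 = fe = 0\<close>. It acts faithfully on three-dimensional space, so two by two matrices
  \<open>s + pe + rf + qef\<close> over \<open>R\<close> become block matrices of size six. The group \<open>K\<close> generated by
  root elements over \<open>R\<close> is perfect, because a torus element moves every root element, but in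
  characteristic two it also contains the scalars \<open>a = 1 + e\<close> and \<open>b = 1 + f\<close>, which are central
  modulo \<open>ef\<close> and have commutator \<open>1 + ef\<close>.

  In \<open>K\<^sup>4\<close> the diagonal together with \<open>(1, 1, a, a)\<close> and \<open>(1, b, 1, b)\<close> generates a subdirect
  subgroup. Its elements have a common \<open>s\<close>, the blocks \<open>p\<close> of the last two coordinates differ from
  the first two by a scalar \<open>t\<close> times \<open>s\<close>, the blocks \<open>r\<close> of the even coordinates differ from
  the odd ones by a scalar \<open>u\<close> times \<open>s\<close>, and the four blocks \<open>q\<close> add up to a scalar \<open>y\<close> times
  \<open>s\<close>. The triple \<open>(t, u, y)\<close> multiplies as in the Heisenberg group.\<close>

section \<open>Groups of class two\<close>

abbreviation comm :: "('a, 'b) monoid_scheme \<Rightarrow> 'a \<Rightarrow> 'a \<Rightarrow> 'a" where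
  "comm G x y \<equiv> x \<otimes>\<^bsub>G\<^esub> y \<otimes>\<^bsub>G\<^esub> inv\<^bsub>G\<^esub> x \<otimes>\<^bsub>G\<^esub> inv\<^bsub>G\<^esub> y"

text \<open>Lets a commutator be read off from an equation between products, so that no matrix
  inverse has to be computed.\<close>

lemma (in group) comm_eqI:
  assumes "x \<in> carrier G" "y \<in> carrier G" "c \<in> carrier G" and "x \<otimes> y = c \<otimes> (y \<otimes> x)"
  shows "comm G x y = c"
proof -
  have "comm G x y = c \<otimes> (y \<otimes> x) \<otimes> inv x \<otimes> inv y" using assms(4) by simp
  also have "\<dots> = c" using assms(1-3) by (simp add: m_assoc inv_solve_right')
  finally show ?thesis .
qed

lemma (in group) comm_eq_one_iff:
  assumes "x \<in> carrier G" "y \<in> carrier G"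
  shows "comm G x y = \<one> \<longleftrightarrow> x \<otimes> y = y \<otimes> x"
proof
  assume "comm G x y = \<one>"
  then have "x \<otimes> y \<otimes> inv x \<otimes> inv y \<otimes> y \<otimes> x = y \<otimes> x" using assms by simp
  then show "x \<otimes> y = y \<otimes> x" using assms by (simp add: m_assoc l_inv)
next
  assume "x \<otimes> y = y \<otimes> x"
  then show "comm G x y = \<one>" using assms by (intro comm_eqI) simp_all
qed

text \<open>Term \<open>1\<close> is generated by central elements, hence central, so term
  \<open>2\<close> is trivial; the non-commuting pair keeps terms \<open>0\<close> and
  \<open>1\<close> nontrivial.\<close>

lemma (in group) class_two:
  assumes central: "\<And>x y z. \<lbrakk>x \<in> carrier G; y \<in> carrier G; z \<in> carrier G\<rbrakk>
      \<Longrightarrow> comm G x y \<otimes> z = z \<otimes> comm G x y"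
    and xy: "x \<in> carrier G" "y \<in> carrier G" "x \<otimes> y \<noteq> y \<otimes> x"
  shows "nilpotent_group G \<and> nilpotency_class G = 2"
proof -
  let ?S = "\<Union>x\<in>carrier G. \<Union>y\<in>carrier G. {comm G x y}"
  have S: "?S \<subseteq> carrier G" by auto
  have lc1: "lower_central G 1 = generate G ?S" by simp
  have cen: "c \<otimes> z = z \<otimes> c" if "c \<in> lower_central G 1" "z \<in> carrier G" for c z
    using that(1) unfolding lc1
  proof (induction rule: generate.induct)
    case (inv h)
    then have h: "h \<in> carrier G" "h \<otimes> z = z \<otimes> h" using central that(2) by auto
    then show ?case
      using that(2) by (metis inv_closed inv_solve_left inv_solve_right m_assoc m_closed)
  next
    case (eng g h)
    then have "g \<in> carrier G" "h \<in> carrier G" using generate_in_carrier[OF S] by blast+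
    then show ?case using eng.IH that(2) by (metis m_assoc)
  qed (use central that(2) in auto)
  have "(\<Union>x\<in>lower_central G 1. \<Union>y\<in>carrier G. {comm G x y}) = {\<one>}"
  proof -
    have "comm G c z = \<one>" if "c \<in> lower_central G 1" "z \<in> carrier G" for c z
      using comm_eq_one_iff cen[OF that] that generate_in_carrier[OF S] unfolding lc1 by blast
    moreover have "\<one> \<in> lower_central G 1" unfolding lc1 by (rule generate.one)
    ultimately show ?thesis by (auto intro!: bexI[of _ \<one>])
  qed
  then have lc2: "lower_central G 2 = {\<one>}"
    using generate_one by (simp add: numeral_2_eq_2)
  have "comm G x y \<noteq> \<one>" using xy by (simp add: comm_eq_one_iff)
  moreover have "comm G x y \<in> lower_central G n" if "n < 2" for n
  proof -
    have "comm G x y \<in> ?S" using xy by blast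
    then have "comm G x y \<in> lower_central G 1" unfolding lc1 by (rule generate.incl)
    then show ?thesis using that xy by (auto simp: less_2_cases_iff)
  qed
  ultimately have least: "2 \<le> n" if "lower_central G n = {\<one>}" for n
    using that by (metis leI singletonD)
  have "nilpotency_class G = 2"
    unfolding nilpotency_class_def using lc2 least by (intro Least_equality) auto
  then show ?thesis using lc2 is_group by (auto simp: nilpotent_group_def)
qed

lemma (in group_hom) image_coset_kernel:
  assumes g: "g \<in> carrier G"
  shows "h ` (kernel G H h #> g) = {h g}"
proof -
  have "h (k \<otimes> g) = h g" if "k \<in> kernel G H h" for k
  proof -
    have k: "k \<in> carrier G" "h k = \<one>\<^bsub>H\<^esub>" using that by (auto simp: kernel_def)
    show ?thesis using hom_mult[OF k(1) g] H.l_one[OF hom_closed[OF g]] unfolding k(2) by simp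
  qed
  then have "h ` (kernel G H h #> g) \<subseteq> {h g}" by (auto simp: r_coset_def)
  moreover have "g \<in> kernel G H h #> g"
    by (rule G.rcos_self[OF g subgroup_kernel])
  ultimately show ?thesis by blast
qed

text \<open>\<open>h\<close> induces an embedding of the quotient in \<open>H\<close>, and
  centrality of commutators is pulled back along it.\<close>

lemma (in group_hom) class_two_quotient:
  assumes central: "\<And>x y z. \<lbrakk>x \<in> carrier H; y \<in> carrier H; z \<in> carrier H\<rbrakk>
      \<Longrightarrow> comm H x y \<otimes>\<^bsub>H\<^esub> z = z \<otimes>\<^bsub>H\<^esub> comm H x y"
    and xy: "x \<in> carrier G" "y \<in> carrier G" "h x \<otimes>\<^bsub>H\<^esub> h y \<noteq> h y \<otimes>\<^bsub>H\<^esub> h x"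
  shows "nilpotent_group (G Mod kernel G H h) \<and> nilpotency_class (G Mod kernel G H h) = 2"
proof -
  define N where "N = kernel G H h"
  interpret N: normal N G unfolding N_def by (rule normal_kernel)
  define f where "f X = the_elem (h ` X)" for X
  interpret f: group_hom "G Mod N" H f
    using FactGroup_hom N.factorgroup_is_group
    by (simp add: N_def f_def [abs_def] group_hom_def group_hom_axioms_def)
  have inj: "inj_on f (carrier (G Mod N))"
    using FactGroup_inj_on by (simp add: N_def f_def [abs_def])
  have f: "f (N #> g) = h g" if "g \<in> carrier G" for g
    using image_coset_kernel[OF that] by (simp add: f_def N_def)
  show ?thesis
    unfolding N_def[symmetric]
  proof (rule f.G.class_two)
    fix a b c assume abc: "a \<in> carrier (G Mod N)" "b \<in> carrier (G Mod N)" "c \<in> carrier (G Mod N)"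
    then have "f (comm (G Mod N) a b \<otimes>\<^bsub>G Mod N\<^esub> c) = f (c \<otimes>\<^bsub>G Mod N\<^esub> comm (G Mod N) a b)"
      by (simp add: central del: mult_FactGroup)
    with inj abc show "comm (G Mod N) a b \<otimes>\<^bsub>G Mod N\<^esub> c = c \<otimes>\<^bsub>G Mod N\<^esub> comm (G Mod N) a b"
      by (intro inj_onD[OF inj]) (auto simp del: mult_FactGroup)
  next
    show mem: "N #> x \<in> carrier (G Mod N)" "N #> y \<in> carrier (G Mod N)"
      using xy by (auto simp: FactGroup_def RCOSETS_def)
    show "(N #> x) \<otimes>\<^bsub>G Mod N\<^esub> (N #> y) \<noteq> (N #> y) \<otimes>\<^bsub>G Mod N\<^esub> (N #> x)"
      using xy f f.hom_mult[OF mem] f.hom_mult[OF mem(2,1)] by metis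
  qed
qed

section \<open>Two by two matrices\<close>

text \<open>A type of fixed size is a ring in the type class sense, so blocks are computed without
  carrier conditions.\<close>

datatype 'a m2 = M2 'a 'a 'a 'a

instantiation m2 :: (comm_ring_1) ring_1
begin
definition "0 = M2 0 0 0 0"
definition "1 = M2 1 0 0 1"
primrec plus_m2 where "M2 a b c d + x = (case x of M2 a' b' c' d' \<Rightarrow> M2 (a + a') (b + b') (c + c') (d + d'))"
primrec uminus_m2 where "- M2 a b c d = M2 (- a) (- b) (- c) (- d)"
definition minus_m2 :: "'a m2 \<Rightarrow> 'a m2 \<Rightarrow> 'a m2" where "minus_m2 x y = x + - y"
primrec times_m2 where "M2 a b c d * x = (case x of M2 a' b' c' d' \<Rightarrow>
  M2 (a * a' + b * c') (a * b' + b * d') (c * a' + d * c') (c * b' + d * d'))"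
instance
proof
  fix x y z :: "'a m2"
  show "x * y * z = x * (y * z)" "x + y + z = x + (y + z)" "x + y = y + x" "x - y = x + - y"
    "(x + y) * z = x * z + y * z" "x * (y + z) = x * y + x * z"
    by (cases x; cases y; cases z; simp add: algebra_simps minus_m2_def)+
  show "1 * x = x" "x * 1 = x" "0 + x = x" "- x + x = 0" "(0::'a m2) \<noteq> 1"
    by (cases x; simp add: one_m2_def zero_m2_def)+
qed
end

lemma M2_char_two:
  fixes x :: "'a::comm_ring_1 m2"
  assumes "(1::'a) + 1 = 0"
  shows "x + x = 0"
proof -
  have "c + c = 0" for c :: 'a using assms by (metis distrib_left mult.right_neutral mult_zero_right)
  then show ?thesis by (cases x) (simp add: zero_m2_def)
qed

text \<open>The element \<open>s + pe + rf + qef\<close>, where \<open>e\<close>, \<open>f\<close>,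
  \<open>ef\<close> act as the three by three matrix units at (1,2), (2,3), (1,3).\<close>

fun blocks :: "'a::comm_ring_1 m2 \<Rightarrow> 'a m2 \<Rightarrow> 'a m2 \<Rightarrow> 'a m2 \<Rightarrow> 'a mat" where
  "blocks (M2 a b c d) (M2 p1 p2 p3 p4) (M2 r1 r2 r3 r4) (M2 q1 q2 q3 q4) = mat_of_rows_list 6
    [[a, b, p1, p2, q1, q2],
     [c, d, p3, p4, q3, q4],
     [0, 0, a, b, r1, r2],
     [0, 0, c, d, r3, r4],
     [0, 0, 0, 0, a, b],
     [0, 0, 0, 0, c, d]]"

lemma blocks_carrier [simp]: "blocks s p r q \<in> carrier_mat 6 6"
  by (cases s; cases p; cases r; cases q) (auto intro!: carrier_matI simp: mat_of_rows_list_def)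

text \<open>The product over \<open>R\<close>: \<open>p * r'\<close> comes from \<open>ef\<close>,
  and \<open>r * p'\<close> is absent since \<open>fe = 0\<close>.\<close>

lemma blocks_mult:
  "blocks s p r q * blocks s' p' r' q' =
    blocks (s * s') (s * p' + p * s') (s * r' + r * s') (s * q' + p * r' + q * s')"
proof (rule eq_matI)
  fix i j assume "i < dim_row (blocks (s * s') (s * p' + p * s') (s * r' + r * s') (s * q' + p * r' + q * s'))"
   "j < dim_col (blocks (s * s') (s * p' + p * s') (s * r' + r * s') (s * q' + p * r' + q * s'))"
  then have "i < 6" "j < 6" by (metis blocks_carrier carrier_matD)+
  then have "i \<in> {0,1,2,3,4,5}" "j \<in> {0,1,2,3,4,5}" by auto
  then show "(blocks s p r q * blocks s' p' r' q') $$ (i, j) =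
    blocks (s * s') (s * p' + p * s') (s * r' + r * s') (s * q' + p * r' + q * s') $$ (i, j)"
    by (cases s; cases p; cases r; cases q; cases s'; cases p'; cases r'; cases q')
     (auto simp: mat_of_rows_list_def scalar_prod_def numeral_eq_Suc algebra_simps)
qed (simp_all add: carrier_matD[OF blocks_carrier])

lemma blocks_one: "blocks 1 0 0 0 = 1\<^sub>m 6"
proof (rule eq_matI)
  fix i j :: nat assume "i < dim_row (1\<^sub>m 6)" "j < dim_col (1\<^sub>m 6)"
  then have "i \<in> {0,1,2,3,4,5}" "j \<in> {0,1,2,3,4,5}" by auto
  then show "blocks 1 0 0 0 $$ (i, j) = 1\<^sub>m 6 $$ (i, j)"
    by (auto simp: one_m2_def zero_m2_def mat_of_rows_list_def)
qed (simp_all add: carrier_matD[OF blocks_carrier])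

lemma blocks_inject:
  "blocks s p r q = blocks s' p' r' q' \<longleftrightarrow> s = s' \<and> p = p' \<and> r = r' \<and> q = q'"
proof 
  assume eq: "blocks s p r q = blocks s' p' r' q'"
  have "blocks s p r q $$ (i,j) = blocks s' p' r' q' $$ (i,j)" for i j using eq by simp
  \<comment> \<open>Rows 0 and 1 show \<open>s\<close>, \<open>p\<close> and \<open>q\<close>; rows
    2 and 3 show \<open>r\<close> in columns 4 and 5.\<close>
  from this[of 0 0] this[of 0 1] this[of 0 2] this[of 0 3] this[of 0 4] this[of 0 5]
    this[of 1 0] this[of 1 1] this[of 1 2] this[of 1 3] this[of 1 4] this[of 1 5]
    this[of 2 4] this[of 2 5] this[of 3 4] this[of 3 5]
  show "s = s' \<and> p = p' \<and> r = r' \<and> q = q'"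
    by (cases s; cases p; cases r; cases q; cases s'; cases p'; cases r'; cases q')
       (simp add: mat_of_rows_list_def)
qed simp

declare blocks.simps [simp del]

section \<open>The Heisenberg group\<close>

text \<open>Unitriangular three by three matrices with \<open>t\<close> and \<open>u\<close> above
  the diagonal and \<open>y\<close> in the corner.\<close>

definition heis :: "('a::comm_ring_1 \<times> 'a \<times> 'a) monoid" where
  "heis = \<lparr>carrier = UNIV,
    monoid.mult = (\<lambda>(t, u, y) (t', u', y'). (t + t', u + u', y + y' + t * u')), one = (0, 0, 0)\<rparr>"

lemma heis_mult [simp]:
  "(t, u, y) \<otimes>\<^bsub>heis\<^esub> (t', u', y') = (t + t', u + u', y + y' + t * u')"
  by (simp add: heis_def)

lemma heis_carrier [simp]: "carrier heis = UNIV"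
  by (simp add: heis_def)

lemma group_heis: "group (heis :: ('a::comm_ring_1 \<times> 'a \<times> 'a) monoid)"
proof (rule groupI)
  fix v :: "'a \<times> 'a \<times> 'a"
  obtain t u y where "v = (t, u, y)" by (cases v)
  then have "(- t, - u, t * u - y) \<otimes>\<^bsub>heis\<^esub> v = \<one>\<^bsub>heis\<^esub>" by (simp add: heis_def)
  then show "\<exists>w \<in> carrier heis. w \<otimes>\<^bsub>heis\<^esub> v = \<one>\<^bsub>heis\<^esub>" by auto
qed (auto simp: heis_def algebra_simps)

lemma heis_commutator_central:
  fixes x y z :: "'a::comm_ring_1 \<times> 'a \<times> 'a"
  shows "comm heis x y \<otimes>\<^bsub>heis\<^esub> z = z \<otimes>\<^bsub>heis\<^esub> comm heis x y"
proof -
  interpret group "heis :: ('a \<times> 'a \<times> 'a) monoid" by (rule group_heis)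
  obtain t u c t' u' c' where xy: "x = (t, u, c)" "y = (t', u', c')" by (cases x; cases y)
  have "comm heis x y = (0, 0, t * u' - t' * u)"
    by (rule comm_eqI) (auto simp: xy algebra_simps)
  then show ?thesis by (cases z) (simp add: add.commute)
qed

section \<open>The perfect group\<close>

text \<open>The determinant squares to \<open>1\<close>, whose only square root in characteristic
  two is \<open>1\<close>; no six by six determinant is expanded.\<close>

lemma involution_in_SL:
  fixes A :: "'f::field mat"
  assumes two: "(1::'f) + 1 = 0" and A: "A \<in> carrier_mat n n" "A * A = 1\<^sub>m n"
  shows "A \<in> carrier (SL n)"
proof -
  have "det A * det A = 1" using det_mult[OF A(1) A(1)] A(2) by simp
  moreover have "- 1 = (1::'f)" using two by (simp add: eq_neg_iff_add_eq_0)
  ultimately have "det A = 1" using square_eq_1_iff by metis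
  then show ?thesis using A by (simp add: SL_def)
qed

lemma one_SL [simp]: "\<one>\<^bsub>SL n\<^esub> = 1\<^sub>m n" and mult_SL [simp]: "A \<otimes>\<^bsub>SL n\<^esub> B = A * B"
  by (simp_all add: SL_def)

definition root_vecs :: "'a::comm_ring_1 m2 set" where
  "root_vecs = range (\<lambda>c. M2 0 c 0 0) \<union> range (\<lambda>c. M2 0 0 c 0)"

text \<open>The root elements \<open>1 + n\<close>, \<open>1 + ne\<close> and \<open>1 + nf\<close>.
  Parts in \<open>ef\<close> arise from products of the last two kinds.\<close>

definition gens :: "'a::comm_ring_1 mat set" where
  "gens = (\<Union>n\<in>root_vecs. {blocks (1 + n) 0 0 0, blocks 1 n 0 0, blocks 1 0 n 0})"

definition scal :: "'a::comm_ring_1 \<Rightarrow> 'a m2" where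
  "scal c = M2 c 0 0 c"

lemma scal_0 [simp]: "scal 0 = 0" and scal_1 [simp]: "scal 1 = 1"
  by (simp_all add: scal_def zero_m2_def one_m2_def)

lemma scal_add: "scal (c + d) = scal c + scal d" and scal_mult: "scal (c * d) = scal c * scal d"
  and scal_inject: "scal c = scal d \<longleftrightarrow> c = d"
  by (simp_all add: scal_def)

lemma scal_central: "x * scal c = scal c * x"
  by (cases x) (simp add: scal_def mult.commute)

text \<open>In characteristic two the second equation makes \<open>w\<close> a primitive cube root
  of unity, with inverse \<open>w * w = w + 1\<close>.\<close>

locale cube_root_char_two =
  fixes w :: "'f::field"
  assumes two: "(1::'f) + 1 = 0" and w: "w * w = w + 1"
begin

abbreviation K :: "'f mat set" where
  "K \<equiv> generate (SL 6) gens"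

abbreviation G :: "'f mat monoid" where
  "G \<equiv> (SL 6)\<lparr>carrier := K\<rparr>"

lemma add_self [simp]: "(c::'f) + c = 0"
  using two by (metis distrib_left mult.right_neutral mult_zero_right)

lemma m2_add_self [simp]: "(x::'f m2) + x = 0"
  by (rule M2_char_two[OF two])

lemma add_self_left [simp]: "(x::'f) + (x + y) = y"
  by (simp flip: add.assoc)

sublocale SL: group "SL 6 :: 'f mat monoid"
  by (rule group_SL)

lemma gens_square: "e \<in> gens \<Longrightarrow> e * e = (1\<^sub>m 6 :: 'f mat)"
  by (auto simp: gens_def root_vecs_def blocks_mult one_m2_def zero_m2_def blocks_one [symmetric])

lemma gens_subset: "gens \<subseteq> carrier (SL 6 :: 'f mat monoid)"
proof
  fix e :: "'f mat" assume e: "e \<in> gens"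
  then have "e \<in> carrier_mat 6 6" by (auto simp: gens_def)
  then show "e \<in> carrier (SL 6)" using involution_in_SL[OF two] gens_square[OF e] by blast
qed

lemma subgroup_K: "subgroup K (SL 6 :: 'f mat monoid)"
  by (rule SL.generate_is_subgroup[OF gens_subset])

lemma K_mult: "x \<in> K \<Longrightarrow> y \<in> K \<Longrightarrow> x * y \<in> (K :: 'f mat set)"
  using generate.eng[of x "SL 6"] by simp

lemma K_gens:
  fixes n :: "'f m2"
  assumes "n \<in> root_vecs"
  shows "blocks (1 + n) 0 0 0 \<in> K" "blocks 1 n 0 0 \<in> K" "blocks 1 0 n 0 \<in> K"
  using assms by (auto simp: gens_def intro!: generate.incl)

lemma root_vecs_M2 [simp]: "M2 0 c 0 0 \<in> root_vecs" "M2 0 0 c 0 \<in> root_vecs"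
  by (auto simp: root_vecs_def)

text \<open>For the matrix units \<open>n\<close> and \<open>m\<close> at positions \<open>(1,2)\<close> and \<open>(2,1)\<close>, conjugating \<open>n\<close> by \<open>1 + m\<close>
  gives \<open>n + m + 1\<close> in characteristic two.\<close>

lemma K_scalar: "blocks 1 1 0 0 \<in> (K :: 'f mat set)" "blocks 1 0 1 0 \<in> (K :: 'f mat set)"
proof -
  let ?n = "M2 0 1 0 0 :: 'f m2" and ?m = "M2 0 0 1 0 :: 'f m2"
  have "blocks 1 1 0 0 = blocks 1 ?n 0 0 * (blocks 1 ?m 0 0 *
      (blocks (1 + ?m) 0 0 0 * (blocks 1 ?n 0 0 * blocks (1 + ?m) 0 0 0)))"
    by (simp add: blocks_mult blocks_inject one_m2_def zero_m2_def)
  then show "blocks 1 1 0 0 \<in> (K :: 'f mat set)" by (simp add: K_mult K_gens)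
  have "blocks 1 0 1 0 = blocks 1 0 ?n 0 * (blocks 1 0 ?m 0 *
      (blocks (1 + ?m) 0 0 0 * (blocks 1 0 ?n 0 * blocks (1 + ?m) 0 0 0)))"
    by (simp add: blocks_mult blocks_inject one_m2_def zero_m2_def)
  then show "blocks 1 0 1 0 \<in> (K :: 'f mat set)" by (simp add: K_mult K_gens)
qed

text \<open>The first three factors multiply to the antidiagonal matrix with entries
  \<open>w\<close> and its inverse \<open>w * w\<close>, the last three to the one with entries
  \<open>1\<close>.\<close>

lemma K_torus: "blocks (M2 w 0 0 (w * w)) 0 0 0 \<in> (K :: 'f mat set)"
proof -
  let ?x = "\<lambda>c::'f. blocks (1 + M2 0 c 0 0) 0 0 0" and ?y = "\<lambda>c::'f. blocks (1 + M2 0 0 c 0) 0 0 0"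
  have "blocks (M2 w 0 0 (w * w)) 0 0 0 = ?x w * (?y (w * w) * (?x w * (?x 1 * (?y 1 * ?x 1))))"
    by (simp add: blocks_mult blocks_inject one_m2_def zero_m2_def w algebra_simps)
  then show ?thesis by (simp add: K_mult K_gens)
qed

text \<open>Conjugation by the torus element scales the two root spaces by \<open>w * w\<close> and
  \<open>w\<close>. Neither is \<open>1\<close>, so conjugation minus the identity is invertible
  there, and \<open>n'\<close> is the preimage of \<open>n\<close>.\<close>

lemma torus_root:
  assumes "n \<in> root_vecs"
  obtains n' :: "'f m2" where "n' \<in> root_vecs" "n * n' = 0"
    "M2 w 0 0 (w * w) * n' = n * M2 w 0 0 (w * w) + n' * M2 w 0 0 (w * w)"
proof -
  consider c where "n = M2 0 c 0 0" | c where "n = M2 0 0 c 0"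
    using assms by (auto simp: root_vecs_def)
  then show thesis
  proof cases
    case 1
    then show thesis
      by (intro that[of "M2 0 (w * w * c) 0 0"]) (simp_all add: zero_m2_def w algebra_simps)
  next
    case 2
    then show thesis
      by (intro that[of "M2 0 0 (w * c) 0"]) (simp_all add: zero_m2_def w algebra_simps)
  qed
qed

text \<open>Says that \<open>e\<close> is the commutator of the torus element with
  \<open>e'\<close>, in the form that \<open>comm_eqI\<close> expects.\<close>

lemma gens_commutator:
  assumes "e \<in> gens"
  obtains e' where "e' \<in> gens"
    "blocks (M2 w 0 0 (w * w)) 0 0 0 * e' = e * (e' * blocks (M2 w 0 0 (w * w)) 0 0 0)"
proof -
  define h where "h = M2 w 0 0 (w * w)"
  obtain n where n: "n \<in> root_vecs" and
    e: "e = blocks (1 + n) 0 0 0 \<or> e = blocks 1 n 0 0 \<or> e = blocks 1 0 n 0"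
    using assms by (auto simp: gens_def)
  obtain n' where n': "n' \<in> root_vecs" "n * n' = 0" "h * n' = n * h + n' * h"
    unfolding h_def by (rule torus_root[OF n])
  note that = that[folded h_def]
  have nn: "n * (n' * h) = 0" using n'(2) by (simp flip: mult.assoc)
  from e show thesis
  proof (elim disjE)
    assume "e = blocks (1 + n) 0 0 0"
    then show thesis using n'(1)
      by (intro that[of "blocks (1 + n') 0 0 0"])
        (auto simp: gens_def blocks_mult blocks_inject algebra_simps n'(3) nn)
  next
    assume "e = blocks 1 n 0 0"
    then show thesis using n'(1)
      by (intro that[of "blocks 1 n' 0 0"])
        (auto simp: gens_def blocks_mult blocks_inject algebra_simps n'(3) nn)
  next
    assume "e = blocks 1 0 n 0"
    then show thesis using n'(1)
      by (intro that[of "blocks 1 0 n' 0"])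
        (auto simp: gens_def blocks_mult blocks_inject algebra_simps n'(3) nn)
  qed
qed

lemma perfect_G: "perfect_group (G :: 'f mat monoid)"
proof -
  have K_sub: "K \<subseteq> carrier (SL 6 :: 'f mat monoid)"
    using subgroup_K by (rule subgroup.subset)
  have "gens \<subseteq> derived (SL 6) (K :: 'f mat set)"
  proof
    fix e :: "'f mat" assume e: "e \<in> gens"
    then obtain e' where e': "e' \<in> gens"
      "blocks (M2 w 0 0 (w * w)) 0 0 0 * e' = e * (e' * blocks (M2 w 0 0 (w * w)) 0 0 0)"
      by (rule gens_commutator)
    have "comm (SL 6) (blocks (M2 w 0 0 (w * w)) 0 0 0) e' = e"
      using e e' K_torus K_sub gens_subset by (intro SL.comm_eqI) auto
    then show "e \<in> derived (SL 6) K"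
      unfolding derived_def using K_torus e'(1)
      by (intro generate.incl) (force intro: generate.incl)
  qed
  then have "K \<subseteq> derived (SL 6) (K :: 'f mat set)"
    by (rule SL.generate_subgroup_incl) (rule SL.derived_is_subgroup[OF K_sub])
  then have "derived (SL 6) K = (K :: 'f mat set)"
    using SL.derived_incl[OF subset_refl subgroup_K] by blast
  then show ?thesis
    \<comment> \<open>The derived subgroup was computed inside \<open>SL 6\<close>; it agrees with
      the one computed in \<open>G\<close>.\<close>
    using SL.derived_consistent[OF subset_refl subgroup_K] SL.subgroup_imp_group[OF subgroup_K]
    by (simp add: perfect_group_def)
qed


section \<open>The subdirect subgroup of the fourth power and its map to the Heisenberg
  group\<close>

abbreviation P :: "(nat \<Rightarrow> 'f mat) monoid" where
  "P \<equiv> product_group {1..4} (\<lambda>_. G)"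

text \<open>The index sets of the two scalar shifts meet only in 4, so their commutator is
  \<open>1 + ef\<close> in coordinate 4 and trivial elsewhere.\<close>

definition hgens :: "(nat \<Rightarrow> 'f mat) set" where
  "hgens = (\<lambda>e. \<lambda>i\<in>{1..4}. e) ` gens \<union>
    {\<lambda>i\<in>{1..4}. blocks 1 (if i \<in> {3, 4} then 1 else 0) 0 0,
     \<lambda>i\<in>{1..4}. blocks 1 0 (if i \<in> {2, 4} then 1 else 0) 0}"

abbreviation H :: "(nat \<Rightarrow> 'f mat) set" where
  "H \<equiv> generate P hgens"

text \<open>An invariant satisfied by all of \<open>H\<close>, used in place of words in the
  generators. The left inverse \<open>s'\<close> is recorded so that \<open>s\<close> can be
  cancelled when recovering \<open>t\<close>, \<open>u\<close>, \<open>y\<close>.\<close>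

definition heis_rel :: "(nat \<Rightarrow> 'f mat) \<Rightarrow> 'f \<times> 'f \<times> 'f \<Rightarrow> bool" where
  "heis_rel x = (\<lambda>(t, u, y). \<exists>s s' p r q. s' * s = 1 \<and> q 1 + q 2 + q 3 + q 4 = scal y * s \<and>
    x = (\<lambda>i\<in>{1..4}. blocks s (p + (if i \<in> {3, 4} then scal t * s else 0))
      (r + (if i \<in> {2, 4} then scal u * s else 0)) (q i)))"

lemma heis_relI:
  assumes "s' * s = 1" "q 1 + q 2 + q 3 + q 4 = scal y * s"
    and "x = (\<lambda>i\<in>{1..4::nat}. blocks s (p + (if i \<in> {3, 4} then scal t * s else 0))
      (r + (if i \<in> {2, 4} then scal u * s else 0)) (q i))"
  shows "heis_rel x (t, u, y)"
  using assms unfolding heis_rel_def by blast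

lemma heis_relE:
  assumes "heis_rel x (t, u, y)"
  obtains s s' p r q where "s' * s = 1" "q 1 + q 2 + q 3 + q 4 = scal y * s"
    "x = (\<lambda>i\<in>{1..4::nat}. blocks s (p + (if i \<in> {3, 4} then scal t * s else 0))
      (r + (if i \<in> {2, 4} then scal u * s else 0)) (q i))"
  using assms unfolding heis_rel_def by blast

text \<open>Scalars commute with \<open>s\<close>, so the shifts add. In the sum of the
  \<open>q\<close> blocks the product of the unshifted blocks occurs four times, each product with
  one shift twice, and the product of both shifts once, which yields \<open>t * u'\<close>.\<close>

lemma heis_rel_mult:
  assumes "heis_rel x (t, u, y)" "heis_rel x' (t', u', y')"
  shows "heis_rel (\<lambda>i\<in>{1..4}. x i * x' i) ((t, u, y) \<otimes>\<^bsub>heis\<^esub> (t', u', y'))"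
proof -
  obtain s k p r q where 1: "k * s = 1" "q 1 + q 2 + q 3 + q 4 = scal y * s"
    "x = (\<lambda>i\<in>{1..4::nat}. blocks s (p + (if i \<in> {3, 4} then scal t * s else 0))
      (r + (if i \<in> {2, 4} then scal u * s else 0)) (q i))"
    using assms(1) by (rule heis_relE)
  obtain s' k' p' r' q' where 2: "k' * s' = 1" "q' 1 + q' 2 + q' 3 + q' 4 = scal y' * s'"
    "x' = (\<lambda>i\<in>{1..4::nat}. blocks s' (p' + (if i \<in> {3, 4} then scal t' * s' else 0))
      (r' + (if i \<in> {2, 4} then scal u' * s' else 0)) (q' i))"
    using assms(2) by (rule heis_relE)
  let ?p = "\<lambda>i::nat. p + (if i \<in> {3, 4} then scal t * s else 0)"
  let ?r = "\<lambda>i::nat. r' + (if i \<in> {2, 4} then scal u' * s' else 0)"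
  define q'' where "q'' i = s * q' i + ?p i * ?r i + q i * s'" for i
  have sc: "s * (scal c * b) = scal c * (s * b)" for b :: "'f m2" and c
    by (metis mult.assoc scal_central)
  have "k' * k * (s * s') = k' * (k * s) * s'" by (simp add: mult.assoc)
  then have s: "k' * k * (s * s') = 1" using 1(1) 2(1) by simp
  \<comment> \<open>In characteristic two only the product of the two scalar shifts survives.\<close>
  have "?p 1 * ?r 1 + ?p 2 * ?r 2 + ?p 3 * ?r 3 + ?p 4 * ?r 4 = (scal t * s) * (scal u' * s')"
    by (simp add: algebra_simps)
  also have "\<dots> = scal (t * u') * (s * s')" by (simp add: sc scal_mult mult.assoc)
  finally have pr: "?p 1 * ?r 1 + ?p 2 * ?r 2 + ?p 3 * ?r 3 + ?p 4 * ?r 4 = scal (t * u') * (s * s')" .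
  have "q'' 1 + q'' 2 + q'' 3 + q'' 4 = s * (q' 1 + q' 2 + q' 3 + q' 4) +
      (?p 1 * ?r 1 + ?p 2 * ?r 2 + ?p 3 * ?r 3 + ?p 4 * ?r 4) + (q 1 + q 2 + q 3 + q 4) * s'"
    unfolding q''_def by (simp only: distrib_left distrib_right ac_simps)
  also have "\<dots> = scal (y + y' + t * u') * (s * s')"
    unfolding pr 1(2) 2(2) by (simp add: sc scal_add distrib_right mult.assoc ac_simps)
  finally have q: "q'' 1 + q'' 2 + q'' 3 + q'' 4 = scal (y + y' + t * u') * (s * s')" .
  show ?thesis
    unfolding heis_mult
  proof (rule heis_relI[OF s q, where p = "s * p' + p * s'" and r = "s * r' + r * s'"], rule restrict_ext)
    fix i :: nat assume "i \<in> {1..4}"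
    then show "x i * x' i = blocks (s * s')
        (s * p' + p * s' + (if i \<in> {3, 4} then scal (t + t') * (s * s') else 0))
        (s * r' + r * s' + (if i \<in> {2, 4} then scal (u + u') * (s * s') else 0)) (q'' i)"
      unfolding 1(3) 2(3) q''_def
      by (simp add: blocks_mult blocks_inject distrib_left distrib_right scal_add sc mult.assoc ac_simps)
  qed
qed

text \<open>Coordinate 1 carries no shift and fixes \<open>p\<close> and \<open>r\<close>; then
  coordinate 3 determines \<open>t\<close>, coordinate 2 determines \<open>u\<close>, and the sum of
  the \<open>q\<close> blocks determines \<open>y\<close>.\<close>

lemma heis_rel_unique:
  assumes "heis_rel x (t, u, y)" "heis_rel x (t', u', y')"
  shows "(t, u, y) = (t', u', y')"
proof -
  obtain s k p r q where 1: "k * s = 1" "q 1 + q 2 + q 3 + q 4 = scal y * s"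
    "x = (\<lambda>i\<in>{1..4::nat}. blocks s (p + (if i \<in> {3, 4} then scal t * s else 0))
      (r + (if i \<in> {2, 4} then scal u * s else 0)) (q i))"
    using assms(1) by (rule heis_relE)
  obtain s' k' p' r' q' where 2: "k' * s' = 1" "q' 1 + q' 2 + q' 3 + q' 4 = scal y' * s'"
    "x = (\<lambda>i\<in>{1..4::nat}. blocks s' (p' + (if i \<in> {3, 4} then scal t' * s' else 0))
      (r' + (if i \<in> {2, 4} then scal u' * s' else 0)) (q' i))"
    using assms(2) by (rule heis_relE)
  have eq: "s = s' \<and> p + (if i \<in> {3, 4} then scal t * s else 0) = p' + (if i \<in> {3, 4} then scal t' * s' else 0)
    \<and> r + (if i \<in> {2, 4} then scal u * s else 0) = r' + (if i \<in> {2, 4} then scal u' * s' else 0) \<and> q i = q' i"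
    if "i \<in> {1..4}" for i
    using fun_cong[OF trans[OF 1(3)[symmetric] 2(3)], of i] unfolding restrict_apply'[OF that] blocks_inject .
  have "scal t * s = scal t' * s" "scal u * s = scal u' * s" "scal y * s = scal y' * s"
    using eq[of 1] eq[of 2] eq[of 3] eq[of 4] 1(2) 2(2) by auto
  moreover have "c = d" if "scal c * s = scal d * s" for c d
  proof -
    have "k * (scal c * s) = scal c" for c using 1(1) by (metis mult.assoc mult.right_neutral scal_central)
    then show ?thesis using that by (metis scal_inject)
  qed
  ultimately show ?thesis by simp
qed

lemma heis_rel_one: "heis_rel (\<lambda>i\<in>{1..4}. 1\<^sub>m 6) (0, 0, 0)"
  by (rule heis_relI[of 1 1 "\<lambda>_. 0" _ _ 0 _ 0]) (auto simp: blocks_one intro!: restrict_ext)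

lemma heis_rel_left: "heis_rel (\<lambda>i\<in>{1..4}. blocks 1 (if i \<in> {3, 4} then 1 else 0) 0 0) (1, 0, 0)"
  by (rule heis_relI[of 1 1 "\<lambda>_. 0" _ _ 0 _ 0]) (auto intro!: restrict_ext)

lemma heis_rel_right: "heis_rel (\<lambda>i\<in>{1..4}. blocks 1 0 (if i \<in> {2, 4} then 1 else 0) 0) (0, 1, 0)"
  by (rule heis_relI[of 1 1 "\<lambda>_. 0" _ _ 0 _ 0]) (auto intro!: restrict_ext)

lemma heis_rel_diagonal:
  assumes "e \<in> gens"
  shows "heis_rel (\<lambda>i\<in>{1..4}. e) (0, 0, 0)"
proof -
  obtain n where n: "n \<in> root_vecs" and
    e: "e = blocks (1 + n) 0 0 0 \<or> e = blocks 1 n 0 0 \<or> e = blocks 1 0 n 0"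
    using assms by (auto simp: gens_def)
  have "(1 + n) * (1 + n) = 1"
    using n by (auto simp: root_vecs_def one_m2_def zero_m2_def)
  with e show ?thesis
    using heis_relI[of "1 + n" "1 + n" "\<lambda>_. 0" 0 _ 0 0 0 0] heis_relI[of 1 1 "\<lambda>_. 0" 0 _ n 0 0 0]
      heis_relI[of 1 1 "\<lambda>_. 0" 0 _ 0 0 n 0]
    by (elim disjE) (simp_all del: One_nat_def cong: if_cong)
qed

sublocale G: group "G :: 'f mat monoid"
  by (rule SL.subgroup_imp_group[OF subgroup_K])

sublocale P: group P
  by (rule product_group) (rule G.is_group)

lemma mult_P: "x \<otimes>\<^bsub>P\<^esub> y = (\<lambda>i\<in>{1..4}. x i * y i)"
  by simp

text \<open>By \<open>K_scalar\<close> the coordinates \<open>1 + e\<close> and \<open>1 + f\<close>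
  of the shifts lie in \<open>K\<close>.\<close>

lemma hgens_subset: "hgens \<subseteq> carrier P"
proof -
  have "blocks 1 0 0 0 \<in> (K :: 'f mat set)" using subgroup.one_closed[OF subgroup_K] by (simp add: blocks_one)
  then show ?thesis
    using K_scalar by (auto simp: hgens_def intro: generate.incl)
qed

lemma subgroup_H: "subgroup H P"
  by (rule P.generate_is_subgroup[OF hgens_subset])

text \<open>Every generator is its own inverse, which settles the inverse case of the induction over
  \<open>H\<close>.\<close>

lemma hgens_square: "x \<in> hgens \<Longrightarrow> x \<otimes>\<^bsub>P\<^esub> x = \<one>\<^bsub>P\<^esub>"
  by (auto simp: hgens_def gens_square blocks_mult simp flip: blocks_one intro!: restrict_ext)

lemma heis_rel_hgens: "x \<in> hgens \<Longrightarrow> \<exists>v. heis_rel x v"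
  using heis_rel_left heis_rel_right heis_rel_diagonal unfolding hgens_def by blast

lemma heis_rel_H: "x \<in> H \<Longrightarrow> \<exists>v. heis_rel x v"
proof (induction rule: generate.induct)
  case one
  have "\<one>\<^bsub>P\<^esub> = (\<lambda>i\<in>{1..4}. 1\<^sub>m 6)" by simp
  then show ?case using heis_rel_one by metis
next
  case (incl x)
  then show ?case by (rule heis_rel_hgens)
next
  case (inv x)
  then have "inv\<^bsub>P\<^esub> x = x"
    using hgens_square hgens_subset by (intro P.inv_equality) auto
  then show ?case using heis_rel_hgens[OF inv] by simp
next
  case (eng x y)
  then obtain v v' where "heis_rel x v" "heis_rel y v'" by blast
  then have "heis_rel (x \<otimes>\<^bsub>P\<^esub> y) (v \<otimes>\<^bsub>heis\<^esub> v')"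
    unfolding mult_P using heis_rel_mult by (cases v; cases v') blast
  then show ?case by blast
qed

definition to_heis :: "(nat \<Rightarrow> 'f mat) \<Rightarrow> 'f \<times> 'f \<times> 'f" where
  "to_heis x = (THE v. heis_rel x v)"

lemma to_heis_eq: "heis_rel x v \<Longrightarrow> to_heis x = v"
  unfolding to_heis_def using heis_rel_unique by (intro the_equality) (metis prod_cases3)+

lemma heis_rel_to_heis: "x \<in> H \<Longrightarrow> heis_rel x (to_heis x)"
  using heis_rel_H to_heis_eq by metis

sublocale to_heis: group_hom "P\<lparr>carrier := H\<rparr>" heis to_heis
proof (intro group_hom.intro group_hom_axioms.intro homI)
  show "group (P\<lparr>carrier := H\<rparr>)" by (rule P.subgroup_imp_group[OF subgroup_H])
  show "group (heis :: ('f \<times> 'f \<times> 'f) monoid)" by (rule group_heis)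
next
  fix x y assume "x \<in> carrier (P\<lparr>carrier := H\<rparr>)" "y \<in> carrier (P\<lparr>carrier := H\<rparr>)"
  then have "heis_rel x (to_heis x)" "heis_rel y (to_heis y)" by (simp_all add: heis_rel_to_heis)
  then have "heis_rel (x \<otimes>\<^bsub>P\<^esub> y) (to_heis x \<otimes>\<^bsub>heis\<^esub> to_heis y)"
    unfolding mult_P using heis_rel_mult by (cases "to_heis x"; cases "to_heis y") simp
  then show "to_heis (x \<otimes>\<^bsub>P\<lparr>carrier := H\<rparr>\<^esub> y) = to_heis x \<otimes>\<^bsub>heis\<^esub> to_heis y"
    using to_heis_eq by simp
qed simp

text \<open>The diagonal elements of \<open>hgens\<close> already project onto the generators of
  \<open>K\<close>.\<close>

lemma subdirect_H: "subdirect_subgroup {1..4} (\<lambda>_. G) H"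
proof -
  have "(\<lambda>x. x i) ` H = K" if i: "i \<in> {1..4}" for i
  proof -
    interpret pr: group_hom P G "\<lambda>x. x i"
      by unfold_locales (use i in \<open>auto simp: hom_def\<close>)
    have "(\<lambda>x. x i) ` H \<subseteq> K"
      using subgroup.subset[OF subgroup_H] pr.hom_closed by auto
    moreover have "subgroup ((\<lambda>x. x i) ` H) (SL 6)"
      using SL.incl_subgroup[OF subgroup_K pr.subgroup_img_is_subgroup[OF subgroup_H]] .
    moreover have "gens \<subseteq> (\<lambda>x. x i) ` H"
    proof
      fix e :: "'f mat" assume "e \<in> gens"
      then have "(\<lambda>i\<in>{1..4}. e) \<in> H" by (intro generate.incl) (auto simp: hgens_def)
      then show "e \<in> (\<lambda>x. x i) ` H" using i by (auto intro: rev_image_eqI)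
    qed
    ultimately show ?thesis using SL.generate_subgroup_incl by blast
  qed
  then show ?thesis using subgroup_H by (simp add: subdirect_subgroup_def)
qed

lemma class_two_H:
  fixes N defines "N \<equiv> kernel (P\<lparr>carrier := H\<rparr>) heis to_heis"
  shows "N \<lhd> P\<lparr>carrier := H\<rparr>" "nilpotent_group (P\<lparr>carrier := H\<rparr> Mod N)"
    "nilpotency_class (P\<lparr>carrier := H\<rparr> Mod N) = 2"
proof -
  let ?x = "\<lambda>i\<in>{1..4}. blocks 1 (if i \<in> {3, 4} then 1 else 0) 0 0 :: 'f mat"
  let ?y = "\<lambda>i\<in>{1..4}. blocks 1 0 (if i \<in> {2, 4} then 1 else 0) 0 :: 'f mat"
  show "N \<lhd> P\<lparr>carrier := H\<rparr>" unfolding N_def by (rule to_heis.normal_kernel)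
  have "?x \<in> H" "?y \<in> H" by (auto intro!: generate.incl simp: hgens_def)
  moreover have "to_heis ?x = (1, 0, 0)" "to_heis ?y = (0, 1, 0)"
    by (intro to_heis_eq heis_rel_left heis_rel_right)+
  \<comment> \<open>The images \<open>(1, 0, 0)\<close> and \<open>(0, 1, 0)\<close> do not commute:
    their two products have last entries \<open>1\<close> and \<open>0\<close>.\<close>
  ultimately have "nilpotent_group (P\<lparr>carrier := H\<rparr> Mod N) \<and> nilpotency_class (P\<lparr>carrier := H\<rparr> Mod N) = 2"
    unfolding N_def
    by (intro to_heis.class_two_quotient[of ?x ?y] heis_commutator_central) simp_all
  then show "nilpotent_group (P\<lparr>carrier := H\<rparr> Mod N)" "nilpotency_class (P\<lparr>carrier := H\<rparr> Mod N) = 2"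
    by simp_all
qed

end

section \<open>The field with four elements\<close>

lemma card_4_cube_root_char_two:
  assumes "card (UNIV :: 'f::field set) = 4"
  obtains w :: "'f::field" where "cube_root_char_two w"
proof -
  have fin: "finite (UNIV :: 'f set)" using assms by (metis card.infinite zero_neq_numeral)
  \<comment> \<open>Translation by \<open>1\<close> permutes the field, so comparing the two sums
    gives \<open>4 = 0\<close>.\<close>
  have "(\<Sum>x\<in>UNIV. x) = (\<Sum>x\<in>UNIV. x + (1::'f))"
    by (rule sum.reindex_bij_witness[of _ "\<lambda>x. x + 1" "\<lambda>x. x - 1"]) auto
  then have "of_nat 4 = (0::'f)" using assms by (simp add: sum.distrib)
  then have "(1 + 1) * (1 + 1) = (0::'f)" by simp
  then have two: "(1::'f) + 1 = 0" by (metis mult_eq_0_iff)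
  have "card {0, 1::'f} \<noteq> card (UNIV :: 'f set)" using assms by simp
  then have "{0, 1::'f} \<noteq> UNIV" by metis
  then obtain w :: 'f where w: "w \<noteq> 0" "w \<noteq> 1" by auto
  have "w + 1 \<noteq> 0" using w(2) two by (metis add_right_cancel)
  then have w1: "w + 1 \<noteq> 0" "w + 1 \<noteq> w" "w + 1 \<noteq> 1" using w by simp_all
  have "card {0, 1, w, w + 1} = 4" using w w1 by simp
  then have "{0, 1, w, w + 1} = UNIV" using assms fin by (metis card_subset_eq subset_UNIV)
  then have "w * w \<in> {0, 1, w, w + 1}" by blast
  \<comment> \<open>Of the four candidates for \<open>w * w\<close>, the values \<open>0\<close> and
    \<open>w\<close> are excluded by the choice of \<open>w\<close>; the value \<open>1\<close>
    would make \<open>w + 1\<close> square to zero.\<close>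
  moreover have "w * w \<noteq> 1"
  proof
    assume "w * w = 1"
    then have "(w + 1) * (w + 1) = 1 + 1 + (w * (1 + 1))" by (simp add: algebra_simps)
    then show False using two w1 by simp
  qed
  ultimately have "w * w = w + 1" using w by auto
  then show thesis using two by (intro that) (simp add: cube_root_char_two_def)
qed

theorem mainTheorem4:
  assumes "card (UNIV :: 'f::field set) = 4"
  shows "\<exists>K. subgroup K (SL 6 :: 'f mat monoid) \<and>
    (let G = (SL 6 :: 'f mat monoid)\<lparr>carrier := K\<rparr>; P = product_group {1..4::nat} (\<lambda>_. G) in
      perfect_group G \<and>
      (\<exists>H. subdirect_subgroup {1..4} (\<lambda>_. G) H \<and>
        (\<exists>N. N \<lhd> P\<lparr>carrier := H\<rparr> \<and>
          nilpotent_group (P\<lparr>carrier := H\<rparr> Mod N) \<and>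
          nilpotency_class (P\<lparr>carrier := H\<rparr> Mod N) = 2)))"
proof -
  obtain w :: 'f where "cube_root_char_two w"
    using assms by (rule card_4_cube_root_char_two)
  then interpret cube_root_char_two w .
  show ?thesis
    unfolding Let_def using subgroup_K perfect_G subdirect_H class_two_H by blast
qed

end
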